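(* Let $n\ge 1$ and let $w=w_1\cdots w_n$ be a permutation in the symmetric group $S_n$. Then the following three numbers are equal: (i) the number $AO(G_w)$ of acyclic orientations of the inversion graph $G_w$; (ii) the number $RP(O_w)$ of placements of $n$ non-attacking rooks on $([n]\times[n])\setminus O_w$; (iii) the number of pseudo-percentage-avoiding fillings of the south-east diagram $E_w$.
   Context: $[n]=\{1,\dots,n\}$. A pair $(i,j)$ with $1\le i<j\le n$ is an inversion of $w$ if $w_i>w_j$. The inversion graph $G_w$ has vertex set $[n]$ and an edge $\{i,j\}$ for each inversion $(i,j)$ of $w$. An acyclic orientation of a graph is an orientation of all its edges with no directed cycle. The entries of $w$ are the cells $(i,w_i)\in[n]\times[n]$. The south-west diagram is $O_w=\{(i,w_j): 1\le i<j\le n,\ w_j>w_i\}\subseteq[n]\times[n]$, and the south-east diagram is $E_w=\{(i,w_j): 1\le i<j\le n,\ w_j<w_i\}\subseteq[n]\times[n]$. A placement of $n$ non-attacking rooks on a set $S\subseteq[n]\times[n]$ is a set of $n$ cells of $S$, no two in the same row (first coordinate) or column (second coordinate). A filling of $E_w$ is a map $A:E_w\to\{0,1\}$. It is pseudo-percentage-avoiding if: (a) whenever $(i,j),(i',j),(i,j'),(i',j')$ all lie in $E_w$, it is not the case that $A_{i,j}=A_{i',j'}=1$ and $A_{i',j}=A_{i,j'}=0$, nor that $A_{i,j}=A_{i',j'}=0$ and $A_{i',j}=A_{i,j'}=1$; and (b) whenever $(i,j),(i',j),(i,j')$ lie in $E_w$ and $j'=w_{i'}$ (i.e. $(i',j')$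 is an entry of $w$), it is not the case that $A_{i,j}=1$ and $A_{i',j}=A_{i,j'}=0$, nor that $A_{i,j}=0$ and $A_{i',j}=A_{i,j'}=1$. *)

theory Defs
  imports "HOL-Combinatorics.Permutations" "HOL-Library.FuncSet"
begin

definition inversions :: "nat \<Rightarrow> (nat \<Rightarrow> nat) \<Rightarrow> (nat \<times> nat) set" where
  "inversions n w = {(i, j). 1 \<le> i \<and> i < j \<and> j \<le> n \<and> w i > w j}"

text \<open>An undirected graph is a pair of a vertex set and a set of edges \<open>{u, v}\<close>.\<close>

type_synonym 'a ugraph = "'a set \<times> 'a set set"

definition inversion_graph :: "nat \<Rightarrow> (nat \<Rightarrow> nat) \<Rightarrow> nat ugraph" where
  "inversion_graph n w = ({1..n}, {{i, j} | i j. (i, j) \<in> inversions n w})"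

text \<open>An orientation is the set \<open>D\<close> of its arcs. The bijection says that every arc lies over an edge
  and that every edge receives exactly one of its two directions.\<close>

definition is_orientation :: "'a ugraph \<Rightarrow> ('a \<times> 'a) set \<Rightarrow> bool" where
  "is_orientation G D \<longleftrightarrow> D \<subseteq> fst G \<times> fst G \<and> bij_betw (\<lambda>(u, v). {u, v}) D (snd G)"

definition acyclic_orientations :: "'a ugraph \<Rightarrow> ('a \<times> 'a) set set" where
  "acyclic_orientations G = {D. is_orientation G D \<and> acyclic D}"

definition SW_diagram :: "nat \<Rightarrow> (nat \<Rightarrow> nat) \<Rightarrow> (nat \<times> nat) set" where
  "SW_diagram n w = {(i, w j) | i j. 1 \<le> i \<and> i < j \<and> j \<le> n \<and> w j > w i}"

definition SE_diagram :: "nat \<Rightarrow> (nat \<Rightarrow> nat) \<Rightarrow> (nat \<times> nat) set" where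
  "SE_diagram n w = {(i, w j) | i j. 1 \<le> i \<and> i < j \<and> j \<le> n \<and> w j < w i}"

definition rook_placements :: "nat \<Rightarrow> (nat \<times> nat) set \<Rightarrow> (nat \<times> nat) set set" where
  "rook_placements n S =
     {R. R \<subseteq> S \<and> finite R \<and> card R = n \<and>
         (\<forall>c\<in>R. \<forall>d\<in>R. c \<noteq> d \<longrightarrow> fst c \<noteq> fst d \<and> snd c \<noteq> snd d)}"

definition pseudo_percentage_avoiding ::
    "nat \<Rightarrow> (nat \<Rightarrow> nat) \<Rightarrow> (nat \<times> nat \<Rightarrow> nat) \<Rightarrow> bool" where
  "pseudo_percentage_avoiding n w A \<longleftrightarrow>
     (\<forall>i i' j j'.
        {(i, j), (i', j), (i, j'), (i', j')} \<subseteq> SE_diagram n w \<longrightarrow>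
          \<not> (A (i, j) = 1 \<and> A (i', j') = 1 \<and> A (i', j) = 0 \<and> A (i, j') = 0) \<and>
          \<not> (A (i, j) = 0 \<and> A (i', j') = 0 \<and> A (i', j) = 1 \<and> A (i, j') = 1)) \<and>
     (\<forall>i i' j j'.
        {(i, j), (i', j), (i, j')} \<subseteq> SE_diagram n w \<and> j' = w i' \<longrightarrow>
          \<not> (A (i, j) = 1 \<and> A (i', j) = 0 \<and> A (i, j') = 0) \<and>
          \<not> (A (i, j) = 0 \<and> A (i', j) = 1 \<and> A (i, j') = 1))"

text \<open>The extensional function space makes distinct functions represent distinct maps
  \<open>SE_diagram n w \<rightarrow> {0, 1}\<close>, so that its subsets have the intended cardinality.\<close>

definition ppa_fillings :: "nat \<Rightarrow> (nat \<Rightarrow> nat) \<Rightarrow> (nat \<times> nat \<Rightarrow> nat) set" where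
  "ppa_fillings n w =
     {A \<in> SE_diagram n w \<rightarrow>\<^sub>E {0, 1}. pseudo_percentage_avoiding n w A}"

end

theory Submission
  imports Defs
begin

text \<open>
  Let \<open>P x y\<close> mean \<open>x < y \<and> w x < w y\<close>; the inversion graph is the incomparability graph of \<open>P\<close>.
  Acyclic orientations correspond to the words on \<open>{1..n}\<close> in which no letter is immediately followed
  by a \<open>P\<close>-smaller one. A rook placement is the graph of \<open>w \<circ> p\<close> for a permutation \<open>p\<close>, and it avoids
  the south-west diagram iff no excedance pair \<open>(i, p i)\<close> satisfies \<open>P\<close>. So the two counts agree because
  the set of descent pairs of words is equidistributed with the set of excedance pairs of permutations.
  Finally, a filling \<open>A\<close> is an orientation, with \<open>i \<rightarrow> k\<close> iff \<open>A (i, w k) = 1\<close>; pseudo-percentage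
  avoidance forbids directed triangles and directed induced 4-cycles, and an incomparability graph has
  no longer shortest directed cycles.
\<close>

section \<open>Orientations of incomparability graphs\<close>

text \<open>Replaces the bijection onto edges by a condition on arcs: injectivity forbids taking
  both directions of an edge, surjectivity demands at least one. Irreflexivity keeps out loops,
  whose two directions would coincide.\<close>

lemma orientation_iff:
  assumes sym: "symp E" and irr: "irreflp E"
  shows "is_orientation (S, {{x, y} | x y. x \<in> S \<and> y \<in> S \<and> E x y}) D \<longleftrightarrow>
    D \<subseteq> {(x, y). x \<in> S \<and> y \<in> S \<and> E x y} \<and>
    (\<forall>x\<in>S. \<forall>y\<in>S. E x y \<longrightarrow> ((x, y) \<in> D \<longleftrightarrow> (y, x) \<notin> D))"
    (is "?L \<longleftrightarrow> ?R1 \<and> ?R2")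
proof
  assume L: ?L
  then have sub: "D \<subseteq> S \<times> S" and inj: "inj_on (\<lambda>(u, v). {u, v}) D"
    and img: "(\<lambda>(u, v). {u, v}) ` D = {{x, y} | x y. x \<in> S \<and> y \<in> S \<and> E x y}"
    by (auto simp: is_orientation_def bij_betw_def)
  have R1: ?R1
  proof clarify
    fix x y assume xy: "(x, y) \<in> D"
    then have "{x, y} \<in> (\<lambda>(u, v). {u, v}) ` D" by force
    then obtain a b where "{x, y} = {a, b}" "E a b" using img by auto
    then have "E x y" using sympD[OF sym] by (auto simp: doubleton_eq_iff)
    then show "x \<in> S \<and> y \<in> S \<and> E x y" using xy sub by auto
  qed
  have R2: ?R2
  proof (intro ballI impI)
    fix x y assume xy: "x \<in> S" "y \<in> S" "E x y"
    then have "{x, y} \<in> (\<lambda>(u, v). {u, v}) ` D" using img by auto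
    then have "(x, y) \<in> D \<or> (y, x) \<in> D" by (auto simp: doubleton_eq_iff)
    moreover have "\<not> ((x, y) \<in> D \<and> (y, x) \<in> D)"
    proof
      assume "(x, y) \<in> D \<and> (y, x) \<in> D"
      then have "x = y" using inj_onD[OF inj, of "(x, y)" "(y, x)"] by auto
      then show False using xy irreflpD[OF irr] by blast
    qed
    ultimately show "(x, y) \<in> D \<longleftrightarrow> (y, x) \<notin> D" by blast
  qed
  show "?R1 \<and> ?R2" using R1 R2 by blast
next
  assume R: "?R1 \<and> ?R2"
  have "inj_on (\<lambda>(u, v). {u, v}) D"
    unfolding inj_on_def using R by (auto simp: doubleton_eq_iff)
  moreover have "(\<lambda>(u, v). {u, v}) ` D = {{x, y} | x y. x \<in> S \<and> y \<in> S \<and> E x y}"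
  proof
    show "(\<lambda>(u, v). {u, v}) ` D \<subseteq> {{x, y} | x y. x \<in> S \<and> y \<in> S \<and> E x y}"
    proof clarify
      fix x y assume "(x, y) \<in> D"
      then show "\<exists>a b. {x, y} = {a, b} \<and> a \<in> S \<and> b \<in> S \<and> E a b" using R by blast
    qed
    show "{{x, y} | x y. x \<in> S \<and> y \<in> S \<and> E x y} \<subseteq> (\<lambda>(u, v). {u, v}) ` D"
    proof clarify
      fix x y assume xy: "x \<in> S" "y \<in> S" "E x y"
      then consider "(x, y) \<in> D" | "(y, x) \<in> D" using R by blast
      then show "{x, y} \<in> (\<lambda>(u, v). {u, v}) ` D"
      proof cases
        case 1
        then show ?thesis by (rule rev_image_eqI) simp
      next
        case 2
        then show ?thesis by (rule rev_image_eqI) (simp add: insert_commute)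
      qed
    qed
  qed
  moreover have "D \<subseteq> S \<times> S" using R by blast
  ultimately show ?L by (simp add: is_orientation_def bij_betw_def)
qed

section \<open>Words as acyclic orientations\<close>

fun arcs :: "('a \<Rightarrow> 'a \<Rightarrow> bool) \<Rightarrow> 'a list \<Rightarrow> ('a \<times> 'a) set" where
  "arcs E [] = {}"
| "arcs E (x # xs) = {(x, y) | y. y \<in> set xs \<and> E x y} \<union> arcs E xs"

lemma arcs_subset: "arcs E xs \<subseteq> {(x, y). x \<in> set xs \<and> y \<in> set xs \<and> E x y}"
  by (induction xs) auto

lemma arcs_tournament:
  assumes "symp E" "irreflp E"
  shows "distinct xs \<Longrightarrow> x \<in> set xs \<Longrightarrow> y \<in> set xs \<Longrightarrow> E x y \<Longrightarrow>
    (x, y) \<in> arcs E xs \<longleftrightarrow> (y, x) \<notin> arcs E xs"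
proof (induction xs)
  case (Cons a xs)
  show ?case
  proof (cases "x = a \<or> y = a")
    case True
    have "E y x" "x \<noteq> y" using Cons.prems sympD[OF assms(1)] irreflpD[OF assms(2)] by blast+
    then show ?thesis using True Cons.prems arcs_subset[of E xs] by auto
  next
    case False
    then show ?thesis using Cons by simp
  qed
qed simp

lemma acyclic_arcs: "distinct xs \<Longrightarrow> acyclic (arcs E xs)"
proof (induction xs)
  case (Cons x xs)
  \<comment> \<open>The head has no incoming arc, so after its first step a path stays among the
    arcs of the tail. A closed path would therefore lie in the tail already.\<close>
  have *: "b \<in> set xs \<and> (a = x \<or> (a, b) \<in> (arcs E xs)\<^sup>+)"
    if "(a, b) \<in> (arcs E (x # xs))\<^sup>+" for a b
    using that
  proof (induction rule: trancl_induct)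
    case (base y)
    then show ?case using arcs_subset[of E xs] by auto
  next
    case (step y z)
    then have "(y, z) \<in> arcs E xs" using Cons.prems by auto
    then show ?case using step arcs_subset[of E xs] by (auto intro: trancl_into_trancl)
  qed
  show ?case
    using Cons * unfolding acyclic_def by (metis distinct.simps(2))
qed (simp add: acyclic_def)

lemma finite_minimal_transp:
  assumes fin: "finite A" and ne: "A \<noteq> {}"
    and trans: "transp P" and irr: "irreflp P"
  shows "\<exists>x\<in>A. \<forall>y\<in>A. \<not> P y x"
proof -
  have "trans {(x, y) \<in> A \<times> A. P x y}" using transpD[OF trans] by (intro transI) blast
  then have "acyclic {(x, y) \<in> A \<times> A. P x y}"
    using irreflpD[OF irr] by (simp add: acyclic_def trancl_id)
  then have "wf {(x, y) \<in> A \<times> A. P x y}"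
    by (intro finite_acyclic_wf finite_subset[OF _ finite_cartesian_product[OF fin fin]]) auto
  then obtain x where "x \<in> A" "\<And>y. (y, x) \<in> {(x, y) \<in> A \<times> A. P x y} \<Longrightarrow> y \<notin> A"
    using ne by (rule wfE_min') blast
  then show ?thesis by blast
qed

text \<open>The sources of an acyclic orientation form a chain; always taking the least one spells a word
  in which no letter is followed by a smaller one.\<close>

lemma acyclic_orientation_word:
  assumes trans: "transp P" and irr: "irreflp P"
    and E: "\<And>x y. E x y \<longleftrightarrow> x \<noteq> y \<and> \<not> P x y \<and> \<not> P y x"
  shows "finite S \<Longrightarrow> D \<subseteq> {(x, y). x \<in> S \<and> y \<in> S \<and> E x y} \<Longrightarrow>
    (\<forall>x\<in>S. \<forall>y\<in>S. E x y \<longrightarrow> ((x, y) \<in> D \<longleftrightarrow> (y, x) \<notin> D)) \<Longrightarrow> acyclic D \<Longrightarrow>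
    \<exists>xs. distinct xs \<and> set xs = S \<and> successively (\<lambda>x y. \<not> P y x) xs \<and> arcs E xs = D"
proof (induction S arbitrary: D rule: finite_psubset_induct)
  case (psubset S)
  show ?case
  proof (cases "S = {}")
    case True
    then show ?thesis using psubset.prems by (intro exI[of _ "[]"]) auto
  next
    case False
    define Src where "Src = {x \<in> S. \<forall>y. (y, x) \<notin> D}"
    have "D \<subseteq> S \<times> S" using psubset.prems(1) by auto
    then have "finite D" using psubset.hyps finite_subset by blast
    then have "wf D" using psubset.prems(3) finite_acyclic_wf by blast
    \<comment> \<open>A minimal element of the well-founded \<open>D\<close> is a source; it only
      serves to show that \<open>Src\<close> is nonempty.\<close>
    then obtain x0 where "x0 \<in> S" "\<And>y. (y, x0) \<in> D \<Longrightarrow> y \<notin> S"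
      using False by (rule wfE_min') blast
    then have "x0 \<in> Src" using psubset.prems(1) by (auto simp: Src_def)
    moreover have "finite Src" using psubset.hyps by (simp add: Src_def)
    ultimately obtain x where x: "x \<in> Src" "\<And>y. y \<in> Src \<Longrightarrow> \<not> P y x"
      using finite_minimal_transp[OF _ _ trans irr, of Src] by blast
    define D' where "D' = {(a, b) \<in> D. a \<noteq> x}"
    have "S - {x} \<subset> S" using x by (auto simp: Src_def)
    moreover have "D' \<subseteq> {(a, b). a \<in> S - {x} \<and> b \<in> S - {x} \<and> E a b}"
      using psubset.prems(1) x by (auto simp: D'_def Src_def)
    moreover have "\<forall>a\<in>S - {x}. \<forall>b\<in>S - {x}. E a b \<longrightarrow> ((a, b) \<in> D' \<longleftrightarrow> (b, a) \<notin> D')"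
      using psubset.prems(2) by (auto simp: D'_def)
    moreover have "acyclic D'"
      by (rule acyclic_subset[OF psubset.prems(3)]) (auto simp: D'_def)
    ultimately obtain ys where ys: "distinct ys" "set ys = S - {x}"
      "successively (\<lambda>x y. \<not> P y x) ys" "arcs E ys = D'"
      using psubset.IH by blast
    \<comment> \<open>If \<open>hd ys\<close> were below \<open>x\<close>, no arc could join the
      two, and as the head of \<open>ys\<close> it receives no arc of \<open>D'\<close> either. It
      would be a source below \<open>x\<close>, against the choice of \<open>x\<close>.\<close>
    have "\<not> P (hd ys) x" if ne: "ys \<noteq> []"
    proof
      assume P: "P (hd ys) x"
      obtain y zs where yz: "ys = y # zs" using ne by (cases ys) auto
      have "(a, y) \<notin> D" for a
      proof
        assume a: "(a, y) \<in> D"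
        show False
        proof (cases "a = x")
          case True
          then show False using a P psubset.prems(1) E yz by auto
        next
          case False
          then have "(a, y) \<in> arcs E ys" using a ys by (simp add: D'_def)
          then show False using yz ys(1) arcs_subset[of E zs] by auto
        qed
      qed
      then have "y \<in> Src" using ys(2) yz by (auto simp: Src_def)
      then show False using x(2) P yz by simp
    qed
    then have "successively (\<lambda>x y. \<not> P y x) (x # ys)"
      using ys(3) by (cases ys) auto
    moreover have "arcs E (x # ys) = D"
    proof -
      \<comment> \<open>Since \<open>x\<close> is a source, every edge at \<open>x\<close> is
        directed away from it, which is what prepending \<open>x\<close> produces.\<close>
      have "(x, y) \<in> D \<longleftrightarrow> y \<in> S - {x} \<and> E x y" for y
        using psubset.prems(1,2) x E by (auto simp: Src_def)
      then have "{(x, y) | y. y \<in> set ys \<and> E x y} \<union> D' = D"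
        unfolding ys(2) D'_def by blast
      then show ?thesis using ys(4) by simp
    qed
    ultimately show ?thesis using ys x by (intro exI[of _ "x # ys"]) (auto simp: Src_def)
  qed
qed

text \<open>Let \<open>z\<close> be the second letter and \<open>y\<close> a later source. By
  induction \<open>y\<close> is not below \<open>z\<close>, and \<open>z\<close> has no arc to
  \<open>y\<close>, so \<open>z\<close> is below \<open>y\<close>. If \<open>y\<close> were below
  \<open>x\<close>, then so would be \<open>z\<close>, a forbidden descent.\<close>

lemma source_not_below_head:
  assumes trans: "transp P"
    and E: "\<And>x y. E x y \<longleftrightarrow> x \<noteq> y \<and> \<not> P x y \<and> \<not> P y x"
  shows "successively (\<lambda>x y. \<not> P y x) (x # xs) \<Longrightarrow> distinct (x # xs) \<Longrightarrow> y \<in> set xs \<Longrightarrow>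
    (\<And>a. (a, y) \<notin> arcs E (x # xs)) \<Longrightarrow> \<not> P y x"
proof (induction xs arbitrary: x)
  case (Cons z zs)
  show ?case
  proof (cases "y = z")
    case True
    then show ?thesis using Cons.prems by simp
  next
    case False
    then have y: "y \<in> set zs" using Cons.prems by simp
    then have "\<not> P y z" using Cons.prems by (intro Cons.IH) auto
    moreover have "\<not> E z y" using Cons.prems(4)[of z] y by simp
    ultimately have "P z y" using E False by blast
    then show ?thesis using transpD[OF trans, of z y x] Cons.prems(1) by auto
  qed
qed simp

lemma head_source: "distinct (x # xs) \<Longrightarrow> (a, x) \<notin> arcs E (x # xs)"
  using arcs_subset[of E xs] by auto

lemma arcs_tail: "distinct (x # xs) \<Longrightarrow> arcs E xs = {(a, b) \<in> arcs E (x # xs). a \<noteq> x}"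
  using arcs_subset[of E xs] by auto

text \<open>The heads of both words are sources of the same orientation, so neither is below the
  other. If they differed, they would be adjacent and the arc between them would enter a source.
  Deleting the common head leaves equal orientations for the tails.\<close>

lemma arcs_inj:
  assumes trans: "transp P"
    and E: "\<And>x y. E x y \<longleftrightarrow> x \<noteq> y \<and> \<not> P x y \<and> \<not> P y x"
  shows "successively (\<lambda>x y. \<not> P y x) xs \<Longrightarrow> distinct xs \<Longrightarrow>
    successively (\<lambda>x y. \<not> P y x) ys \<Longrightarrow> distinct ys \<Longrightarrow> set xs = set ys \<Longrightarrow>
    arcs E xs = arcs E ys \<Longrightarrow> xs = ys"
proof (induction xs arbitrary: ys)
  case (Cons x xs)
  then obtain y ys' where ys: "ys = y # ys'" by (cases ys) auto
  note eq = Cons.prems(6)[unfolded ys]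
  have src_x: "(a, x) \<notin> arcs E (y # ys')" for a
    using head_source[OF Cons.prems(2), of a E] unfolding eq .
  have src_y: "(a, y) \<notin> arcs E (x # xs)" for a
    using head_source[of y ys' a E] Cons.prems(4) unfolding eq ys by blast
  have xy: "x = y"
  proof (rule ccontr)
    assume ne: "x \<noteq> y"
    have y: "y \<in> set xs" and x: "x \<in> set ys'" using Cons.prems(5) ys ne by auto
    have "\<not> P y x"
      by (rule source_not_below_head[OF trans E Cons.prems(1,2) y src_y])
    moreover have "\<not> P x y"
      by (rule source_not_below_head[OF trans E Cons.prems(3,4)[unfolded ys] x src_x])
    ultimately have "(x, y) \<in> arcs E (x # xs)" using E ne y by simp
    then show False using src_y by blast
  qed
  have "set xs = set ys'" using Cons.prems(2,4,5) ys xy by auto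
  moreover have "arcs E xs = arcs E ys'"
    using arcs_tail[OF Cons.prems(2), of E] arcs_tail[of y ys' E] Cons.prems(4) eq ys xy by metis
  ultimately have "xs = ys'"
    using Cons.prems(1-4) ys by (intro Cons.IH) (auto simp: successively_Cons)
  then show ?case using ys xy by simp
qed simp

lemma card_acyclic_orientations_incomparability:
  assumes fin: "finite S"
    and trans: "transp P" and irr: "irreflp P"
    and E: "\<And>x y. E x y \<longleftrightarrow> x \<noteq> y \<and> \<not> P x y \<and> \<not> P y x"
  shows "card (acyclic_orientations (S, {{x, y} | x y. x \<in> S \<and> y \<in> S \<and> E x y})) =
    card {xs. distinct xs \<and> set xs = S \<and> successively (\<lambda>x y. \<not> P y x) xs}"
proof -
  let ?W = "{xs. distinct xs \<and> set xs = S \<and> successively (\<lambda>x y. \<not> P y x) xs}"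
  let ?G = "(S, {{x, y} | x y. x \<in> S \<and> y \<in> S \<and> E x y})"
  have symE: "symp E" and irrE: "irreflp E" using E by (auto intro: sympI irreflpI)
  note orient = orientation_iff[OF symE irrE]
  have inj: "inj_on (arcs E) ?W"
    using arcs_inj[OF trans E] by (auto intro!: inj_onI)
  have img: "arcs E ` ?W = acyclic_orientations ?G"
  proof
    show "arcs E ` ?W \<subseteq> acyclic_orientations ?G"
    proof clarify
      fix xs assume xs: "distinct xs" "S = set xs"
      then have "is_orientation (set xs, {{x, y} | x y. x \<in> set xs \<and> y \<in> set xs \<and> E x y})
          (arcs E xs)"
        unfolding orient using arcs_subset[of E xs] arcs_tournament[OF symE irrE]
        by blast
      then show "arcs E xs \<in> acyclic_orientations
          (set xs, {{x, y} | x y. x \<in> set xs \<and> y \<in> set xs \<and> E x y})"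
        using acyclic_arcs[OF xs(1)] by (simp add: acyclic_orientations_def)
    qed
    show "acyclic_orientations ?G \<subseteq> arcs E ` ?W"
    proof
      fix D assume "D \<in> acyclic_orientations ?G"
      then have "is_orientation ?G D" "acyclic D" by (auto simp: acyclic_orientations_def)
      then obtain xs where "distinct xs \<and> set xs = S \<and> successively (\<lambda>x y. \<not> P y x) xs \<and> arcs E xs = D"
        using acyclic_orientation_word[OF trans irr E fin, of D] unfolding orient by blast
      then show "D \<in> arcs E ` ?W" by blast
    qed
  qed
  show ?thesis unfolding img[symmetric] by (rule card_image[OF inj])
qed

section \<open>Descents of words and excedances of permutations\<close>

text \<open>The smaller letter is stored first, although it stands second in the word, so that the
  pairs have the form of the pairs \<open>(i, p i)\<close> in \<open>exc_pairs\<close>.\<close>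

fun desc_pairs :: "nat list \<Rightarrow> (nat \<times> nat) set" where
  "desc_pairs (x # y # xs) = (if y < x then {(y, x)} else {}) \<union> desc_pairs (y # xs)"
| "desc_pairs _ = {}"

definition exc_pairs :: "(nat \<Rightarrow> nat) \<Rightarrow> (nat \<times> nat) set" where
  "exc_pairs p = {(i, p i) | i. i < p i}"

text \<open>An absent \<open>a\<close> means appending. For \<open>m\<close> not in the word,
  letting \<open>a\<close> range over its letters and \<open>m\<close> itself reaches each insertion
  position of a distinct word exactly once.\<close>

fun insert_before :: "'a \<Rightarrow> 'a \<Rightarrow> 'a list \<Rightarrow> 'a list" where
  "insert_before m a [] = [m]"
| "insert_before m a (x # xs) = (if x = a then m # x # xs else x # insert_before m a xs)"

lemma set_insert_before [simp]: "set (insert_before m a xs) = insert m (set xs)"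
  by (induction xs) auto

lemma distinct_insert_before [simp]:
  "distinct (insert_before m a xs) \<longleftrightarrow> m \<notin> set xs \<and> distinct xs"
  by (induction xs) auto

lemma remove1_insert_before: "m \<notin> set xs \<Longrightarrow> remove1 m (insert_before m a xs) = xs"
  by (induction xs) auto

lemma insert_before_inj:
  "m \<notin> set xs \<Longrightarrow> a \<in> insert m (set xs) \<Longrightarrow> b \<in> insert m (set xs) \<Longrightarrow>
    insert_before m a xs = insert_before m b xs \<Longrightarrow> a = b"
  by (induction xs) (auto split: if_splits)

lemma insert_before_append:
  "a \<notin> set us \<Longrightarrow> insert_before m a (us @ a # vs) = us @ m # a # vs"
  by (induction us) auto

lemma insert_before_end: "a \<notin> set xs \<Longrightarrow> insert_before m a xs = xs @ [m]"
  by (induction xs) auto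

text \<open>The tail in the first factor matters: in a distinct word the head is never the lower
  letter of a descent.\<close>

lemma desc_pairs_subset: "desc_pairs xs \<subseteq> set (tl xs) \<times> set xs"
  by (induction xs rule: desc_pairs.induct) (auto split: if_splits)

text \<open>As \<open>m\<close> exceeds all letters, it forms an ascent with the letter before it
  and a descent with \<open>a\<close> after it. The only adjacency destroyed is the one ending in
  \<open>a\<close>, and only this one can have \<open>a\<close> as its lower letter.\<close>

lemma desc_pairs_insert_before:
  "distinct xs \<Longrightarrow> \<forall>x\<in>set xs. x < m \<Longrightarrow> a \<in> insert m (set xs) \<Longrightarrow>
    desc_pairs (insert_before m a xs) =
      {p \<in> desc_pairs xs. fst p \<noteq> a} \<union> (if a = m then {} else {(a, m)})"
proof (induction xs rule: desc_pairs.induct)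
  case (1 x y xs)
  have head: "{p \<in> desc_pairs (z # zs). fst p \<noteq> z} = desc_pairs (z # zs)"
    if "z \<notin> set zs" for z zs
    using desc_pairs_subset[of "z # zs"] that by auto
  consider "x = a" | "x \<noteq> a" "y = a" | "x \<noteq> a" "y \<noteq> a" by blast
  then show ?case
  proof cases
    case 1
    then have "{p \<in> desc_pairs (x # y # xs). fst p \<noteq> a} = desc_pairs (x # y # xs)"
      using head[of x "y # xs"] "1.prems" by simp
    then show ?thesis using 1 "1.prems" by simp
  next
    case 2
    then have "{p \<in> desc_pairs (x # y # xs). fst p \<noteq> a} = desc_pairs (y # xs)"
      using head[of y xs] "1.prems" by auto
    then show ?thesis using 2 "1.prems" by simp
  next
    case 3
    have "desc_pairs (insert_before m a (x # y # xs)) =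
        (if y < x then {(y, x)} else {}) \<union> desc_pairs (insert_before m a (y # xs))"
      using 3 by simp
    also have "desc_pairs (insert_before m a (y # xs)) =
        {p \<in> desc_pairs (y # xs). fst p \<noteq> a} \<union> (if a = m then {} else {(a, m)})"
      using "1.prems" 3 by (intro "1.IH") auto
    finally show ?thesis using 3 by auto
  qed
next
  case "2_1"
  then show ?case by simp
next
  case ("2_2" x)
  then show ?case by (cases "x = a") auto
qed

text \<open>The composite sends \<open>a\<close> to \<open>Suc k\<close> and \<open>Suc k\<close> to
  \<open>p a\<close>, which is at most \<open>Suc k\<close>. So \<open>a\<close> gets the new pair
  in place of any old one, \<open>Suc k\<close> contributes none, and all other points keep their
  images.\<close>

lemma exc_pairs_transpose:
  assumes "p permutes {1..k}" "a \<in> {1..Suc k}"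
  shows "exc_pairs (p \<circ> transpose a (Suc k)) =
    {q \<in> exc_pairs p. fst q \<noteq> a} \<union> (if a = Suc k then {} else {(a, Suc k)})"
proof -
  have fix_m: "p (Suc k) = Suc k" using assms(1) by (simp add: permutes_def)
  have le: "p a \<le> Suc k" using assms permutes_in_image[OF assms(1), of a] fix_m
    by (cases "a = Suc k") auto
  show ?thesis
  proof (intro set_eqI, clarify)
    fix i j
    show "(i, j) \<in> exc_pairs (p \<circ> transpose a (Suc k)) \<longleftrightarrow>
      (i, j) \<in> {q \<in> exc_pairs p. fst q \<noteq> a} \<union> (if a = Suc k then {} else {(a, Suc k)})"
      using assms(2) fix_m le
      by (cases "i = a"; cases "i = Suc k"; cases "a = Suc k")
         (auto simp: exc_pairs_def transpose_def)
  qed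
qed

lemma words_Suc:
  "bij_betw (\<lambda>(a, xs). insert_before (Suc k) a xs)
     ({1..Suc k} \<times> {xs. distinct xs \<and> set xs = {1..k}}) {xs. distinct xs \<and> set xs = {1..Suc k}}"
  (is "bij_betw ?f (_ \<times> ?W) ?W'")
proof (intro bij_betw_imageI)
  show "inj_on ?f ({1..Suc k} \<times> ?W)"
  proof (intro inj_onI, clarify)
    fix a b xs ys
    assume *: "insert_before (Suc k) a xs = insert_before (Suc k) b ys"
      "set xs = {1..k}" "set ys = {1..k}" "a \<in> {1..Suc k}" "b \<in> {1..Suc k}"
    then have "xs = ys"
      using remove1_insert_before[of "Suc k" xs a] remove1_insert_before[of "Suc k" ys b] by auto
    moreover have "a = b"
      using * \<open>xs = ys\<close> by (intro insert_before_inj[of "Suc k" xs]) auto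
    ultimately show "a = b \<and> xs = ys" by simp
  qed
  show "?f ` ({1..Suc k} \<times> ?W) = ?W'"
  proof
    have "insert (Suc k) {1..k} = {1..Suc k}" by auto
    then show "?f ` ({1..Suc k} \<times> ?W) \<subseteq> ?W'" by auto
    show "?W' \<subseteq> ?f ` ({1..Suc k} \<times> ?W)"
    proof
      fix ys assume ys: "ys \<in> ?W'"
      then have "Suc k \<in> set ys" by auto
      then obtain us vs where uv: "ys = us @ Suc k # vs" by (meson split_list)
      have set: "set (us @ vs) = {1..k}"
      proof -
        have "set (us @ vs) = set ys - {Suc k}" using ys uv by auto
        also have "\<dots> = {1..Suc k} - {Suc k}" using ys by simp
        also have "\<dots> = {1..k}" by auto
        finally show ?thesis .
      qed
      have dist: "distinct (us @ vs)" using ys uv by auto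
      show "ys \<in> ?f ` ({1..Suc k} \<times> ?W)"
      \<comment> \<open>The inverse deletes \<open>Suc k\<close>. The insertion point is the letter
        that followed it, or \<open>Suc k\<close> itself if it stood last.\<close>
      proof (cases vs)
        case Nil
        then have "insert_before (Suc k) (Suc k) us = ys"
          using ys uv by (simp add: insert_before_end)
        then show ?thesis using set dist Nil by (intro image_eqI[of _ _ "(Suc k, us)"]) auto
      next
        case (Cons a ws)
        then have "insert_before (Suc k) a (us @ vs) = ys"
          using dist uv by (simp add: insert_before_append)
        moreover have "a \<in> set (us @ vs)" using Cons by simp
        then have "a \<in> {1..Suc k}" unfolding set by simp
        ultimately show ?thesis
          using set dist by (intro image_eqI[of _ _ "(a, us @ vs)"]) simp_all
      qed
    qed
  qed
qed

lemma permutations_Suc: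
  "bij_betw (\<lambda>(a, p). p \<circ> transpose a (Suc k))
     ({1..Suc k} \<times> {p. p permutes {1..k}}) {p. p permutes {1..Suc k}}"
  (is "bij_betw ?f (_ \<times> ?P) ?P'")
proof (intro bij_betw_imageI)
  have fix_m: "p (Suc k) = Suc k" if "p permutes {1..k}" for p
    using that by (simp add: permutes_def)
  show "inj_on ?f ({1..Suc k} \<times> ?P)"
  proof (intro inj_onI, clarify)
    fix a b p q
    assume *: "p \<circ> transpose a (Suc k) = q \<circ> transpose b (Suc k)"
      "p permutes {1..k}" "q permutes {1..k}"
    have "p (transpose a (Suc k) a) = q (transpose b (Suc k) a)"
      using fun_cong[OF *(1), of a] by simp
    then have "q (Suc k) = q (transpose b (Suc k) a)"
      using fix_m[OF *(2)] fix_m[OF *(3)] by simp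
    \<comment> \<open>Only one point is sent to \<open>Suc k\<close> by each composite, namely
      \<open>a\<close> respectively \<open>b\<close>.\<close>
    then have "transpose b (Suc k) a = Suc k"
      using permutes_inj[OF *(3)] by (metis injD)
    then have ab: "a = b" by (metis transpose_apply_first transpose_eq_iff)
    have "p = (p \<circ> transpose a (Suc k)) \<circ> transpose a (Suc k)" by (simp add: comp_assoc)
    also have "\<dots> = q" using *(1) ab by (simp add: comp_assoc)
    finally show "a = b \<and> p = q" using ab by simp
  qed
  show "?f ` ({1..Suc k} \<times> ?P) = ?P'"
  proof
    show "?f ` ({1..Suc k} \<times> ?P) \<subseteq> ?P'"
    proof clarify
      fix a p assume a: "a \<in> {1..Suc k}" and "p permutes {1..k}"
      then have "p permutes {1..Suc k}" by (elim permutes_subset) auto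
      then show "p \<circ> transpose a (Suc k) permutes {1..Suc k}"
        using a by (intro permutes_compose permutes_swap_id) auto
    qed
    show "?P' \<subseteq> ?f ` ({1..Suc k} \<times> ?P)"
    proof clarify
      fix p assume p: "p permutes {1..Suc k}"
      \<comment> \<open>The point sent to \<open>Suc k\<close> is the only possible
        \<open>a\<close>. Composing with the transposition makes \<open>Suc k\<close> a fixed point,
        and transposing again recovers \<open>p\<close>.\<close>
      define a where "a = inv p (Suc k)"
      have a: "a \<in> {1..Suc k}" "p a = Suc k"
        using permutes_inverses[OF p] permutes_in_image[OF permutes_inv[OF p], of "Suc k"]
        by (auto simp: a_def)
      define q where "q = p \<circ> transpose a (Suc k)"
      have "q permutes {1..Suc k}"
        unfolding q_def using a p by (intro permutes_compose permutes_swap_id) auto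
      moreover have "q x = x" if "x \<in> {1..Suc k} - {1..k}" for x
      proof -
        have "x = Suc k" using that by auto
        then show ?thesis using a by (simp add: q_def)
      qed
      ultimately have "q permutes {1..k}" by (rule permutes_superset)
      moreover have "p = q \<circ> transpose a (Suc k)" by (simp add: q_def comp_assoc)
      ultimately show "p \<in> ?f ` ({1..Suc k} \<times> ?P)"
        using a(1) by (intro image_eqI[of _ _ "(a, q)"]) auto
    qed
  qed
qed

text \<open>Splits a count by the insertion point, so that the induction hypothesis can be applied
  for each fixed \<open>a\<close>.\<close>

lemma card_Collect_bij_Times:
  assumes bij: "bij_betw f (A \<times> B) C" and fin: "finite A" "finite B"
  shows "card {c \<in> C. Q c} = (\<Sum>a\<in>A. card {b \<in> B. Q (f (a, b))})"
proof -
  have "bij_betw f {x \<in> A \<times> B. Q (f x)} {c \<in> C. Q c}"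
    using bij by (auto simp: bij_betw_def inj_on_def)
  then have "card {c \<in> C. Q c} = card {x \<in> A \<times> B. Q (f x)}"
    by (rule bij_betw_same_card[symmetric])
  also have "{x \<in> A \<times> B. Q (f x)} = (SIGMA a:A. {b \<in> B. Q (f (a, b))})" by auto
  also have "card \<dots> = (\<Sum>a\<in>A. card {b \<in> B. Q (f (a, b))})"
    using fin by (intro card_SigmaI) auto
  finally show ?thesis .
qed

lemma finite_words: "finite {xs. distinct xs \<and> set xs = {1..k::nat}}"
  by (rule finite_subset[OF _ finite_lists_length_le[of "{1..k}" k]])
     (auto dest!: distinct_card)

text \<open>Inserting the largest letter \<open>m\<close> before \<open>a\<close> changes the descent pairs of a word exactly as
  inserting \<open>m\<close> after \<open>a\<close> in its cycle changes the excedance pairs of a permutation;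
  \<open>a = m\<close> encodes appending \<open>m\<close>, respectively adding a fixed point.\<close>

lemma card_desc_pairs_eq_exc_pairs:
  "card {xs \<in> {xs. distinct xs \<and> set xs = {1..k}}. Q (desc_pairs xs)} =
   card {p \<in> {p. p permutes {1..k}}. Q (exc_pairs p)}"
proof (induction k arbitrary: Q)
  case 0
  have "{xs \<in> {xs. distinct xs \<and> set xs = {1..0::nat}}. Q (desc_pairs xs)} =
      (if Q {} then {[]} else {})" by auto
  moreover have "{p \<in> {p. p permutes {1..0::nat}}. Q (exc_pairs p)} =
      (if Q {} then {id} else {})"
    by (auto simp: exc_pairs_def)
  ultimately show ?case by simp
next
  case (Suc k)
  \<comment> \<open>Words and permutations undergo this same update, which depends only on the set
    of pairs. The induction hypothesis can thus be used with \<open>Q (U a X)\<close> in place of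
    \<open>Q X\<close>, which is why \<open>Q\<close> is kept arbitrary.\<close>
  define U where "U a X = {q \<in> X. fst q \<noteq> a} \<union> (if a = Suc k then {} else {(a, Suc k)})"
    for a and X :: "(nat \<times> nat) set"
  let ?W = "{xs. distinct xs \<and> set xs = {1..k}}"
  let ?P = "{p. p permutes {1..k}}"
  have "card {xs \<in> {xs. distinct xs \<and> set xs = {1..Suc k}}. Q (desc_pairs xs)} =
      (\<Sum>a\<in>{1..Suc k}. card {xs \<in> ?W. Q (desc_pairs (insert_before (Suc k) a xs))})"
    using card_Collect_bij_Times[OF words_Suc[of k] _ finite_words] by simp
  also have "\<dots> = (\<Sum>a\<in>{1..Suc k}. card {xs \<in> ?W. Q (U a (desc_pairs xs))})"
  proof (intro sum.cong refl arg_cong[where f = card] Collect_cong conj_cong)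
    fix a xs assume "a \<in> {1..Suc k}" "xs \<in> ?W"
    then show "Q (desc_pairs (insert_before (Suc k) a xs)) = Q (U a (desc_pairs xs))"
      unfolding U_def by (subst desc_pairs_insert_before) auto
  qed
  also have "\<dots> = (\<Sum>a\<in>{1..Suc k}. card {p \<in> ?P. Q (U a (exc_pairs p))})"
    using Suc.IH[of "\<lambda>X. Q (U a X)" for a] by simp
  also have "\<dots> = (\<Sum>a\<in>{1..Suc k}. card {p \<in> ?P. Q (exc_pairs (p \<circ> transpose a (Suc k)))})"
    by (intro sum.cong refl arg_cong[where f = card] Collect_cong conj_cong)
       (simp add: exc_pairs_transpose U_def)
  also have "\<dots> = card {p \<in> {p. p permutes {1..Suc k}}. Q (exc_pairs p)}"
    using card_Collect_bij_Times[OF permutations_Suc[of k] _ finite_permutations[of "{1..k}"],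
        where Q = "\<lambda>p. Q (exc_pairs p)"] by simp
  finally show ?case .
qed

lemma successively_iff_desc_pairs:
  "successively (\<lambda>x y. \<not> (y < x \<and> R y x)) xs \<longleftrightarrow> (\<forall>(y, x)\<in>desc_pairs xs. \<not> R y x)"
  by (induction xs rule: desc_pairs.induct) auto

section \<open>Rook placements\<close>

lemma card_rook_placements:
  assumes w: "w permutes {1..n}"
  shows "card (rook_placements n ({1..n} \<times> {1..n} - SW_diagram n w)) =
    card {p \<in> {p. p permutes {1..n}}. \<forall>(i, j)\<in>exc_pairs p. \<not> w i < w j}"
proof -
  let ?RP = "rook_placements n ({1..n} \<times> {1..n} - SW_diagram n w)"
  let ?P = "{p \<in> {p. p permutes {1..n}}. \<forall>(i, j)\<in>exc_pairs p. \<not> w i < w j}"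
  let ?f = "\<lambda>p. (\<lambda>i. (i, w (p i))) ` {1..n}"
  have w_eq: "w x = w y \<longleftrightarrow> x = y" for x y using permutes_inj[OF w] by (auto dest: injD)
  have w_in: "w x \<in> {1..n} \<longleftrightarrow> x \<in> {1..n}" for x using permutes_in_image[OF w] .
  have SW: "(i, w j) \<in> SW_diagram n w \<longleftrightarrow> 1 \<le> i \<and> i < j \<and> j \<le> n \<and> w i < w j" for i j
    by (auto simp: SW_diagram_def w_eq)
  have inj: "inj_on ?f ?P"
  proof (intro inj_onI, clarify)
    fix p q assume *: "?f p = ?f q" "p permutes {1..n}" "q permutes {1..n}"
    show "p = q"
    proof
      fix i
      show "p i = q i"
      proof (cases "i \<in> {1..n}")
        case True
        then have "(i, w (p i)) \<in> ?f p" by blast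
        then have "(i, w (p i)) \<in> ?f q" unfolding *(1) .
        then show ?thesis using w_eq by auto
      next
        case False
        then show ?thesis using *(2,3) by (simp add: permutes_def)
      qed
    qed
  qed
  have img: "?f ` ?P = ?RP"
  proof
    show "?f ` ?P \<subseteq> ?RP"
    proof clarify
      fix p assume p: "p permutes {1..n}" and exc: "\<forall>(i, j)\<in>exc_pairs p. \<not> w i < w j"
      have p_in: "p x \<in> {1..n} \<longleftrightarrow> x \<in> {1..n}" for x using permutes_in_image[OF p] .
      have p_eq: "p x = p y \<longleftrightarrow> x = y" for x y using permutes_inj[OF p] by (auto dest: injD)
      have "?f p \<subseteq> {1..n} \<times> {1..n} - SW_diagram n w"
      proof
        fix c assume "c \<in> ?f p"
        then obtain i where i: "i \<in> {1..n}" "c = (i, w (p i))" by blast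
        have "\<not> (i < p i \<and> w i < w (p i))" using exc by (auto simp: exc_pairs_def)
        then show "c \<in> {1..n} \<times> {1..n} - SW_diagram n w"
          using i p_in[of i] w_in[of "p i"] by (auto simp: SW)
      qed
      moreover have "card (?f p) = n" by (subst card_image) (auto simp: inj_on_def)
      ultimately show "?f p \<in> ?RP"
        by (auto simp: rook_placements_def w_eq p_eq)
    qed
    show "?RP \<subseteq> ?f ` ?P"
    proof
      fix R assume "R \<in> ?RP"
      then have sub: "R \<subseteq> {1..n} \<times> {1..n} - SW_diagram n w" and card: "card R = n"
        and fst: "inj_on fst R" and snd: "inj_on snd R"
        by (auto simp: rook_placements_def inj_on_def)
      \<comment> \<open>With \<open>n\<close> rooks in distinct rows every row is occupied, so
        \<open>R\<close> is the graph of a function \<open>s\<close>.\<close>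
      have fstR: "fst ` R = {1..n}"
        using sub card card_image[OF fst] by (intro card_subset_eq) auto
      have "\<forall>i\<in>{1..n}. \<exists>c. (i, c) \<in> R" using fstR by (metis image_iff prod.collapse)
      then obtain s where s: "\<And>i. i \<in> {1..n} \<Longrightarrow> (i, s i) \<in> R" by metis
      \<comment> \<open>Chosen to solve \<open>w (p i) = s i\<close> on the board;
        \<open>permutes\<close> requires the identity elsewhere.\<close>
      define p where "p i = (if i \<in> {1..n} then inv w (s i) else i)" for i
      have wp: "w (p i) = s i" if "i \<in> {1..n}" for i
        using that permutes_inverses[OF w] by (simp add: p_def)
      have p_in: "p i \<in> {1..n}" if "i \<in> {1..n}" for i
        using s[OF that] sub wp[OF that] w_in[of "p i"] by auto
      have "inj_on p {1..n}"
      proof (intro inj_onI)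
        fix i j assume ij: "i \<in> {1..n}" "j \<in> {1..n}" "p i = p j"
        then have "s i = s j" using wp by metis
        then show "i = j"
          using inj_onD[OF snd _ s[OF ij(1)] s[OF ij(2)]] by simp
      qed
      then have "bij_betw p {1..n} {1..n}"
        using p_in by (intro bij_betw_imageI endo_inj_surj) auto
      then have "p permutes {1..n}" by (rule bij_imp_permutes) (auto simp: p_def)
      moreover have "\<forall>(i, j)\<in>exc_pairs p. \<not> w i < w j"
      proof (clarsimp simp: exc_pairs_def)
        fix i assume i: "i < p i" "w i < w (p i)"
        then have i_in: "i \<in> {1..n}" by (auto simp: p_def split: if_splits)
        then show False using i s[OF i_in] sub p_in[OF i_in] SW[of i "p i"] wp by auto
      qed
      moreover have "?f p = R"
      proof
        show "?f p \<subseteq> R" using s wp by auto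
        show "R \<subseteq> ?f p"
        proof
          fix c assume c: "c \<in> R"
          then have i: "fst c \<in> {1..n}" using fstR by blast
          then have "c = (fst c, s (fst c))" using fst c s[OF i] by (auto simp: inj_on_def)
          then show "c \<in> ?f p" using i wp[OF i] by (intro image_eqI[of _ _ "fst c"]) simp_all
        qed
      qed
      ultimately show "R \<in> ?f ` ?P" by blast
    qed
  qed
  show ?thesis unfolding img[symmetric] by (rule card_image[OF inj])
qed

section \<open>Fillings\<close>

text \<open>Along a sequence with incomparable neighbours, comparability at distances two and three
  propagates the direction of the first comparison, so the even-indexed terms increase.\<close>

lemma alternate_vertices_chain:
  fixes c :: "nat \<Rightarrow> 'a"
  assumes trans: "transp R"
    and adj: "\<And>i. \<not> R (c i) (c (Suc i))" "\<And>i. \<not> R (c (Suc i)) (c i)"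
    and two: "\<And>i. R (c i) (c (i + 2)) \<or> R (c (i + 2)) (c i)"
    and three: "\<And>i. R (c i) (c (i + 3)) \<or> R (c (i + 3)) (c i)"
    and start: "R (c 0) (c 2)"
  shows "R (c 0) (c (2 * Suc j))"
proof -
  \<comment> \<open>Four comparisons are forced in turn: each reversed one would combine with its
    predecessor by transitivity to make two neighbours comparable.\<close>
  have step: "R (c (i + 2)) (c (i + 4))" if *: "R (c i) (c (i + 2))" for i
  proof -
    have "R (c i) (c (i + 3))"
      using three[of i] transpD[OF trans _ *, of "c (i + 3)"] adj[of "i + 2"]
      by (auto simp: eval_nat_numeral)
    then have "R (c (i + 1)) (c (i + 3))"
      using two[of "i + 1"] transpD[OF trans, of "c i" "c (i + 3)" "c (i + 1)"] adj[of i]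
      by (auto simp: eval_nat_numeral)
    then have "R (c (i + 1)) (c (i + 4))"
      using three[of "i + 1"] transpD[OF trans, of "c (i + 4)" "c (i + 1)" "c (i + 3)"] adj[of "i + 3"]
      by (auto simp: eval_nat_numeral)
    then show ?thesis
      using two[of "i + 2"] transpD[OF trans, of "c (i + 1)" "c (i + 4)" "c (i + 2)"] adj[of "i + 1"]
      by (auto simp: eval_nat_numeral)
  qed
  have "R (c (2 * j)) (c (2 * j + 2))" for j
    by (induction j) (use start step in \<open>auto simp: eval_nat_numeral\<close>)
  then have mono: "R (c (2 * j)) (c (2 * Suc j))" for j by simp
  show ?thesis
  proof (induction j)
    case 0
    then show ?case using start by simp
  next
    case (Suc j)
    then show ?case using mono[of "Suc j"] transpD[OF trans] by blast
  qed
qed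

text \<open>A shortest directed cycle is chordless. If its length is at least 5, then going around it in
  steps of two yields a strictly monotone sequence, which is absurd.\<close>

lemma acyclic_if_no_short_cycles:
  assumes trans: "transp P" and irr: "irreflp P"
    and arc: "\<And>x y. (x, y) \<in> D \<Longrightarrow> \<not> P x y \<and> \<not> P y x"
    and total: "\<And>x y. x \<in> Field D \<Longrightarrow> y \<in> Field D \<Longrightarrow> x \<noteq> y \<Longrightarrow>
      P x y \<or> P y x \<or> (x, y) \<in> D \<or> (y, x) \<in> D"
    and asym: "\<And>x y. (x, y) \<in> D \<Longrightarrow> (y, x) \<notin> D"
    and tri: "\<And>x y z. (x, y) \<in> D \<Longrightarrow> (y, z) \<in> D \<Longrightarrow> (z, x) \<in> D \<Longrightarrow> False"
    and quad: "\<And>a b c d. (a, b) \<in> D \<Longrightarrow> (b, c) \<in> D \<Longrightarrow> (c, d) \<in> D \<Longrightarrow> (d, a) \<in> D \<Longrightarrow>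
      P a c \<or> P c a \<Longrightarrow> P b d \<or> P d b \<Longrightarrow> False"
  shows "acyclic D"
proof (rule ccontr)
  assume "\<not> acyclic D"
  then obtain x where "(x, x) \<in> D\<^sup>+" by (auto simp: acyclic_def)
  then have ex: "\<exists>k. 0 < k \<and> (\<exists>x. (x, x) \<in> D ^^ k)" by (auto simp: trancl_power)
  \<comment> \<open>The least length of a closed walk.\<close>
  define k where "k = (LEAST k. 0 < k \<and> (\<exists>x. (x, x) \<in> D ^^ k))"
  have k: "0 < k" "\<exists>x. (x, x) \<in> D ^^ k"
    using LeastI_ex[OF ex] by (auto simp: k_def)
  have min: "(y, y) \<notin> D ^^ m" if "0 < m" "m < k" for y m
    using not_less_Least that unfolding k_def by blast
  obtain f where f: "f 0 = f k" "\<And>i. i < k \<Longrightarrow> (f i, f (Suc i)) \<in> D"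
    using k(2) unfolding relpow_fun_conv by metis
  \<comment> \<open>Periodic continuation of the cycle, so that indices may run past the
    end.\<close>
  define c where "c i = f (i mod k)" for i
  have c_arc: "(c i, c (Suc i)) \<in> D" for i
    using f(2)[of "i mod k"] f(1) k(1) by (auto simp: c_def mod_Suc)
  have c_add: "c (i + k) = c i" "c (i + m * k) = c i" for i m by (auto simp: c_def)
  have c_walk: "(c i, c (i + d)) \<in> D ^^ d" for i d
    by (induction d) (use c_arc in \<open>auto intro: relcompI\<close>)
  have c_back: "(c (i + d), c i) \<in> D ^^ (k - d)" if "d \<le> k" for i d
    using c_walk[of "i + d" "k - d"] that c_add(1)[of i] by simp
  have c_Field: "c i \<in> Field D" for i using c_arc[of i] by (auto simp: Field_def)
  \<comment> \<open>A chord at distance \<open>d\<close> would close a walk of length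
    \<open>k - d + 1\<close> or \<open>d + 1\<close>, and a repeated vertex one of length
    \<open>d\<close>. All are below \<open>k\<close> in the stated range of \<open>d\<close>, so
    only comparability remains.\<close>
  have chordless: "P (c i) (c (i + d)) \<or> P (c (i + d)) (c i)" if d: "2 \<le> d" "d + 2 \<le> k" for i d
  proof -
    have "c i \<noteq> c (i + d)" using min[of d "c i"] c_walk[of i d] d by auto
    moreover have "(c i, c (i + d)) \<notin> D"
    proof
      assume "(c i, c (i + d)) \<in> D"
      then have "(c i, c i) \<in> D ^^ Suc (k - d)" using c_back[of d i] d
        by (intro relpow_Suc_I2) auto
      then show False using min[of "Suc (k - d)"] d by auto
    qed
    moreover have "(c (i + d), c i) \<notin> D"
    proof
      assume "(c (i + d), c i) \<in> D"
      then have "(c i, c i) \<in> D ^^ Suc d" using c_walk[of i d] by auto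
      then show False using min[of "Suc d"] d by auto
    qed
    ultimately show ?thesis using total c_Field by blast
  qed
  consider "k = 1" | "k = 2" | "k = 3" | "k = 4" | "5 \<le> k" using k(1) by linarith
  then show False
  proof cases
    case 1
    then show False using c_arc[of 0] asym c_add(1)[of 0] by auto
  next
    case 2
    then show False using c_arc[of 0] c_arc[of 1] asym c_add(1)[of 0]
      by (auto simp: eval_nat_numeral)
  next
    case 3
    then show False using c_arc[of 0] c_arc[of 1] c_arc[of 2] tri c_add(1)[of 0]
      by (auto simp: eval_nat_numeral)
  next
    case 4
    have "(c 0, c 1) \<in> D" "(c 1, c 2) \<in> D" "(c 2, c 3) \<in> D" "(c 3, c 0) \<in> D"
      using c_arc[of 0] c_arc[of 1] c_arc[of 2] c_arc[of 3] c_add(1)[of 0] 4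
      by (simp_all add: eval_nat_numeral)
    moreover have "P (c 0) (c 2) \<or> P (c 2) (c 0)" "P (c 1) (c 3) \<or> P (c 3) (c 1)"
      using chordless[of 2 0] chordless[of 2 1] 4 by (simp_all add: eval_nat_numeral)
    ultimately show False by (rule quad)
  next
    case 5
    have adj: "\<not> P (c i) (c (Suc i))" "\<not> P (c (Suc i)) (c i)" for i using arc c_arc by blast+
    have two: "P (c i) (c (i + 2)) \<or> P (c (i + 2)) (c i)" for i
      using chordless[of 2 i] 5 by simp
    \<comment> \<open>Distance three meets the bound in \<open>chordless\<close> only for
      \<open>k\<close> at least 5, hence the separate treatment of 4-cycles.\<close>
    have three: "P (c i) (c (i + 3)) \<or> P (c (i + 3)) (c i)" for i
      using chordless[of 3 i] 5 by simp
    \<comment> \<open>The index is \<open>2 * k\<close>: two full turns, so that steps of two return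
      to the start for odd \<open>k\<close> as well.\<close>
    have ret: "c (2 * Suc (k - 1)) = c 0" using c_add(2)[of 0 2] k(1)
      by (simp only: Suc_diff_1 add_0)
    \<comment> \<open>Stated for a general \<open>Q\<close> because the first comparison may point
      either way; it is applied to \<open>P\<close> and to its converse.\<close>
    have no_chain: False
      if "transp Q" "irreflp Q"
        and "\<And>i. \<not> Q (c i) (c (Suc i))" "\<And>i. \<not> Q (c (Suc i)) (c i)"
        and "\<And>i. Q (c i) (c (i + 2)) \<or> Q (c (i + 2)) (c i)"
        and "\<And>i. Q (c i) (c (i + 3)) \<or> Q (c (i + 3)) (c i)"
        and "Q (c 0) (c 2)" for Q
    proof -
      have "Q (c 0) (c 0)"
        using alternate_vertices_chain[of Q c "k - 1", OF that(1,3-7)] unfolding ret .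
      then show False by (rule irreflpD[OF that(2), THEN notE])
    qed
    have "P (c 0) (c 2) \<or> P (c 2) (c 0)" using two[of 0] unfolding add_0 .
    then show False
    proof
      assume "P (c 0) (c 2)"
      with trans irr adj two three show False by (rule no_chain)
    next
      assume "P (c 2) (c 0)"
      have "transp P\<inverse>\<inverse>" "irreflp P\<inverse>\<inverse>" using trans irr by simp_all
      then show False
        by (rule no_chain) (use adj two three \<open>P (c 2) (c 0)\<close> in blast)+
    qed
  qed
qed

section \<open>Fillings as orientations of the inversion graph\<close>

definition filling_orientation ::
    "nat \<Rightarrow> (nat \<Rightarrow> nat) \<Rightarrow> (nat \<times> nat \<Rightarrow> nat) \<Rightarrow> (nat \<times> nat) set" where
  "filling_orientation n w A =
     {(i, k). (i, k) \<in> inversions n w \<and> A (i, w k) = 1} \<union>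
     {(k, i). (i, k) \<in> inversions n w \<and> A (i, w k) = 0}"

text \<open>Naming a column by the position \<open>k\<close> of its entry turns cells of the diagram
  into edges of the inversion graph.\<close>

lemma SE_diagram_iff:
  assumes "w permutes {1..n}"
  shows "(i, w k) \<in> SE_diagram n w \<longleftrightarrow> (i, k) \<in> inversions n w"
  using permutes_inj[OF assms] by (auto simp: SE_diagram_def inversions_def dest: injD)

lemma acyclic_filling_orientation_iff:
  assumes w: "w permutes {1..n}" and A: "A \<in> SE_diagram n w \<rightarrow> {0, 1}"
  shows "acyclic (filling_orientation n w A) \<longleftrightarrow> pseudo_percentage_avoiding n w A"
proof -
  let ?D = "filling_orientation n w A"
  note SE = SE_diagram_iff[OF w]
  have w_eq: "w x = w y \<longleftrightarrow> x = y" for x y using permutes_inj[OF w] by (auto dest: injD)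
  have A01: "A (i, w k) = 0 \<or> A (i, w k) = 1" if "(i, k) \<in> inversions n w" for i k
    using A that SE by blast
  have col: "\<exists>k. j = w k \<and> (i, k) \<in> inversions n w" if "(i, j) \<in> SE_diagram n w" for i j
    using that by (auto simp: SE_diagram_def inversions_def)
  have fwd: "(i, k) \<in> ?D" if "(i, k) \<in> inversions n w" "A (i, w k) = 1" for i k
    using that by (simp add: filling_orientation_def)
  have bwd: "(k, i) \<in> ?D" if "(i, k) \<in> inversions n w" "A (i, w k) = 0" for i k
    using that by (simp add: filling_orientation_def)
  have D_iff: "(x, y) \<in> ?D \<longleftrightarrow> (x, y) \<in> inversions n w \<and> A (x, w y) = 1 \<or>
      (y, x) \<in> inversions n w \<and> A (y, w x) = 0" for x y
    by (simp add: filling_orientation_def)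
  show ?thesis
  proof
    assume ac: "acyclic ?D"
    have no3: False if "(a, b) \<in> ?D" "(b, c) \<in> ?D" "(c, a) \<in> ?D" for a b c
      using ac trancl_into_trancl[OF trancl_into_trancl[OF r_into_trancl[OF that(1)] that(2)] that(3)]
      unfolding acyclic_def by blast
    have no4: False if "(a, b) \<in> ?D" "(b, c) \<in> ?D" "(c, d) \<in> ?D" "(d, a) \<in> ?D" for a b c d
      using ac trancl_trans[OF trancl_into_trancl[OF r_into_trancl[OF that(1)] that(2)]
          trancl_into_trancl[OF r_into_trancl[OF that(3)] that(4)]]
      unfolding acyclic_def by blast
    show "pseudo_percentage_avoiding n w A"
      unfolding pseudo_percentage_avoiding_def
    proof (intro conjI allI impI)
      fix i i' j j'
      assume cells: "{(i, j), (i', j), (i, j'), (i', j')} \<subseteq> SE_diagram n w"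
      then have "(i, j) \<in> SE_diagram n w" "(i, j') \<in> SE_diagram n w" by simp_all
      then obtain k k' where j: "j = w k" "j' = w k'" by (metis col)
      have inv: "(i, k) \<in> inversions n w" "(i', k) \<in> inversions n w"
        "(i, k') \<in> inversions n w" "(i', k') \<in> inversions n w"
        using cells unfolding j by (simp_all add: SE)
      \<comment> \<open>This pattern is the directed cycle from \<open>i\<close> through
        \<open>k\<close>, \<open>i'\<close>, \<open>k'\<close> back to \<open>i\<close>; the
        opposite pattern reverses it.\<close>
      show "\<not> (A (i, j) = 1 \<and> A (i', j') = 1 \<and> A (i', j) = 0 \<and> A (i, j') = 0)"
        unfolding j using no4[of i k i' k'] inv fwd bwd by blast
      show "\<not> (A (i, j) = 0 \<and> A (i', j') = 0 \<and> A (i', j) = 1 \<and> A (i, j') = 1)"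
        unfolding j using no4[of k i k' i'] inv fwd bwd by blast
    next
      fix i i' j j'
      assume cells: "{(i, j), (i', j), (i, j')} \<subseteq> SE_diagram n w \<and> j' = w i'"
      then have "(i, j) \<in> SE_diagram n w" by simp
      then obtain k where j: "j = w k" by (metis col)
      have j': "j' = w i'" using cells by simp
      have inv: "(i, k) \<in> inversions n w" "(i', k) \<in> inversions n w"
        "(i, i') \<in> inversions n w"
        using cells unfolding j j' by (simp_all add: SE)
      \<comment> \<open>Here the column of \<open>j'\<close> belongs to \<open>i'\<close>, so the
        three cells are the edges of the triangle \<open>i\<close>, \<open>i'\<close>,
        \<open>k\<close>; the two patterns are its cyclic orientations.\<close>
      show "\<not> (A (i, j) = 1 \<and> A (i', j) = 0 \<and> A (i, j') = 0)"
        unfolding j j' using no3[of i k i'] inv fwd bwd by blast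
      show "\<not> (A (i, j) = 0 \<and> A (i', j) = 1 \<and> A (i, j') = 1)"
        unfolding j j' using no3[of i i' k] inv fwd bwd by blast
    qed
  next
    assume ppa: "pseudo_percentage_avoiding n w A"
    have rect: "\<not> (A (i, w k) = 1 \<and> A (i', w k') = 1 \<and> A (i', w k) = 0 \<and> A (i, w k') = 0)"
      if "(i, k) \<in> inversions n w" "(i', k) \<in> inversions n w"
        "(i, k') \<in> inversions n w" "(i', k') \<in> inversions n w" for i i' k k'
      using ppa that SE unfolding pseudo_percentage_avoiding_def by simp
    have inv_lt: "x < y \<and> w y < w x \<and> 1 \<le> x \<and> y \<le> n" if "(x, y) \<in> inversions n w" for x y
      using that by (simp add: inversions_def)
    have inv_trans: "(x, z) \<in> inversions n w"
      if "(x, y) \<in> inversions n w" "(y, z) \<in> inversions n w" for x y z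
      using that by (simp add: inversions_def)
    have arc_inv: "(x, y) \<in> inversions n w \<or> (y, x) \<in> inversions n w" if "(x, y) \<in> ?D" for x y
      using that unfolding D_iff by blast
    have inv_asym: "(y, x) \<notin> inversions n w" if "(x, y) \<in> inversions n w" for x y
      using that by (simp add: inversions_def)
    have val: "A (x, w y) = 1" if "(x, y) \<in> ?D" "(x, y) \<in> inversions n w" for x y
      using that inv_asym unfolding D_iff by blast
    have val': "A (y, w x) = 0" if "(x, y) \<in> ?D" "(y, x) \<in> inversions n w" for x y
      using that inv_asym unfolding D_iff by blast
    \<comment> \<open>By transitivity the positions \<open>i\<close>, \<open>j\<close>,
      \<open>k\<close> form a triangle. Its cyclic orientations are the patterns of condition (b) in
      rows \<open>i\<close>, \<open>j\<close> and columns \<open>w j\<close>,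
      \<open>w k\<close>.\<close>
    have chain: "\<not> ((i, k) \<in> ?D \<and> (k, j) \<in> ?D \<and> (j, i) \<in> ?D)"
      "\<not> ((i, j) \<in> ?D \<and> (j, k) \<in> ?D \<and> (k, i) \<in> ?D)"
      if ij: "(i, j) \<in> inversions n w" and jk: "(j, k) \<in> inversions n w" for i j k
    proof -
      note ik = inv_trans[OF ij jk]
      have "{(i, w k), (j, w k), (i, w j)} \<subseteq> SE_diagram n w \<and> w j = w j"
        using ij jk ik SE by simp
      then have "\<not> (A (i, w k) = 1 \<and> A (j, w k) = 0 \<and> A (i, w j) = 0)"
        "\<not> (A (i, w k) = 0 \<and> A (j, w k) = 1 \<and> A (i, w j) = 1)"
        using ppa unfolding pseudo_percentage_avoiding_def by blast+
      then show "\<not> ((i, k) \<in> ?D \<and> (k, j) \<in> ?D \<and> (j, i) \<in> ?D)"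
        "\<not> ((i, j) \<in> ?D \<and> (j, k) \<in> ?D \<and> (k, i) \<in> ?D)"
        using val val' ij jk ik by blast+
    qed
    have cycle3: "\<not> ((a, b) \<in> inversions n w \<and> (b, c) \<in> inversions n w)"
      "\<not> ((c, b) \<in> inversions n w \<and> (b, a) \<in> inversions n w)"
      if "(a, b) \<in> ?D" "(b, c) \<in> ?D" "(c, a) \<in> ?D" for a b c
      using that chain(2)[of a b c] chain(1)[of c b a] by blast+
    define P where "P x y \<longleftrightarrow> x < y \<and> w x < w y" for x y
    show "acyclic ?D"
    proof (rule acyclic_if_no_short_cycles[of P])
      show "transp P" by (auto simp: P_def intro: transpI)
      show "irreflp P" by (auto simp: P_def intro: irreflpI)
      show "\<not> P x y \<and> \<not> P y x" if "(x, y) \<in> ?D" for x y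
        using that inv_lt unfolding D_iff P_def by fastforce
      show "P x y \<or> P y x \<or> (x, y) \<in> ?D \<or> (y, x) \<in> ?D"
        if "x \<in> Field ?D" "y \<in> Field ?D" "x \<noteq> y" for x y
      proof -
        have F: "z \<in> {1..n}" if "z \<in> Field ?D" for z
          using that unfolding Field_def by (auto simp: D_iff inversions_def)
        have "x \<in> {1..n}" "y \<in> {1..n}" "w x \<noteq> w y" using that F w_eq by auto
        then have "P x y \<or> P y x \<or> (x, y) \<in> inversions n w \<or> (y, x) \<in> inversions n w"
          using that(3) by (auto simp: P_def inversions_def)
        then show ?thesis using A01 fwd bwd by blast
      qed
      show "(y, x) \<notin> ?D" if "(x, y) \<in> ?D" for x y
        using arc_inv[OF that] val[of x y] val[of y x] val'[of x y] val'[of y x] that by auto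
      \<comment> \<open>Of three arcs two agree in going with or against the order of positions, and
        any two arcs of a triangle are consecutive. So \<open>cycle3\<close> applies after a
        rotation.\<close>
      show False if "(x, y) \<in> ?D" "(y, z) \<in> ?D" "(z, x) \<in> ?D" for x y z
        using arc_inv[OF that(1)] arc_inv[OF that(2)] arc_inv[OF that(3)]
          cycle3[OF that] cycle3[OF that(2,3,1)] cycle3[OF that(3,1,2)]
        by blast
      show False
        if arcs: "(a, b) \<in> ?D" "(b, c) \<in> ?D" "(c, d) \<in> ?D" "(d, a) \<in> ?D"
          and ac: "P a c \<or> P c a" and bd: "P b d \<or> P d b" for a b c d
      proof -
        have P_inv: "(x, y) \<notin> inversions n w" "(y, x) \<notin> inversions n w"
          if "P x y \<or> P y x" for x y
          using that inv_lt[of x y] inv_lt[of y x] by (auto simp: P_def)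
        \<comment> \<open>Two consecutive arcs in the same direction would make a diagonal an
          inversion, but the diagonals are comparable under \<open>P\<close>. Hence directions
          alternate, the vertices split into two rows and two columns, and condition (a)
          applies.\<close>
        have "\<not> ((a, b) \<in> inversions n w \<and> (b, c) \<in> inversions n w)"
          "\<not> ((c, b) \<in> inversions n w \<and> (b, a) \<in> inversions n w)"
          "\<not> ((b, c) \<in> inversions n w \<and> (c, d) \<in> inversions n w)"
          "\<not> ((d, c) \<in> inversions n w \<and> (c, b) \<in> inversions n w)"
          "\<not> ((c, d) \<in> inversions n w \<and> (d, a) \<in> inversions n w)"
          "\<not> ((a, d) \<in> inversions n w \<and> (d, c) \<in> inversions n w)"
          using P_inv[OF ac] P_inv[OF bd] inv_trans by blast+
        then consider
          "(a, b) \<in> inversions n w" "(c, b) \<in> inversions n w"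
            "(c, d) \<in> inversions n w" "(a, d) \<in> inversions n w"
          | "(b, a) \<in> inversions n w" "(b, c) \<in> inversions n w"
            "(d, c) \<in> inversions n w" "(d, a) \<in> inversions n w"
          using arcs[THEN arc_inv] by blast
        then show False
        proof cases
          case 1
          then show False
            using rect[of a b c d] val[OF arcs(1)] val'[OF arcs(2)] val[OF arcs(3)] val'[OF arcs(4)]
            by blast
        next
          case 2
          then show False
            using rect[of b c d a] val'[OF arcs(1)] val[OF arcs(2)] val'[OF arcs(3)] val[OF arcs(4)]
            by blast
        qed
      qed
    qed
  qed
qed

text \<open>Brings the graph into the form with a symmetric relation that
  \<open>orientation_iff\<close> and the count of words expect.\<close>

lemma inversion_graph_eq:
  "inversion_graph n w = ({1..n}, {{x, y} | x y. x \<in> {1..n} \<and> y \<in> {1..n} \<and>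
     (x < y \<and> w y < w x \<or> y < x \<and> w x < w y)})"
proof -
  let ?E = "\<lambda>x y. x < y \<and> w y < w x \<or> y < x \<and> w x < w y"
  have "{{i, j} | i j. (i, j) \<in> inversions n w} =
      {{x, y} | x y. x \<in> {1..n} \<and> y \<in> {1..n} \<and> ?E x y}" (is "?L = ?R")
  proof
    show "?L \<subseteq> ?R"
    proof clarify
      fix i j assume "(i, j) \<in> inversions n w"
      then show "\<exists>x y. {i, j} = {x, y} \<and> x \<in> {1..n} \<and> y \<in> {1..n} \<and> ?E x y"
        by (intro exI[of _ i] exI[of _ j]) (simp add: inversions_def)
    qed
    show "?R \<subseteq> ?L"
    proof clarify
      fix x y assume xy: "x \<in> {1..n}" "y \<in> {1..n}" "?E x y"
      then consider "(x, y) \<in> inversions n w" | "(y, x) \<in> inversions n w"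
        by (auto simp: inversions_def)
      then show "\<exists>i j. {x, y} = {i, j} \<and> (i, j) \<in> inversions n w"
        using insert_commute[of x y "{}"] by cases blast+
    qed
  qed
  then show ?thesis unfolding inversion_graph_def by (rule arg_cong)
qed

lemma card_ppa_fillings:
  assumes w: "w permutes {1..n}"
  shows "card (ppa_fillings n w) = card (acyclic_orientations (inversion_graph n w))"
proof -
  let ?F = "filling_orientation n w"
  let ?E = "\<lambda>x y. x < y \<and> w y < w x \<or> y < x \<and> w x < w y"
  note SE = SE_diagram_iff[OF w]
  have col: "\<exists>k. j = w k \<and> (i, k) \<in> inversions n w" if "(i, j) \<in> SE_diagram n w" for i j
    using that by (auto simp: SE_diagram_def inversions_def)
  have orient: "is_orientation (inversion_graph n w) D \<longleftrightarrow>
      D \<subseteq> {(x, y). x \<in> {1..n} \<and> y \<in> {1..n} \<and> ?E x y} \<and>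
      (\<forall>x\<in>{1..n}. \<forall>y\<in>{1..n}. ?E x y \<longrightarrow> ((x, y) \<in> D \<longleftrightarrow> (y, x) \<notin> D))" for D
    unfolding inversion_graph_eq by (rule orientation_iff) (auto intro: sympI irreflpI)
  have inv_iff: "(x, y) \<in> inversions n w \<longleftrightarrow> x \<in> {1..n} \<and> y \<in> {1..n} \<and> x < y \<and> w y < w x" for x y
    by (auto simp: inversions_def)
  have inj: "inj_on ?F (ppa_fillings n w)"
  proof (intro inj_onI)
    fix A B assume "A \<in> ppa_fillings n w" "B \<in> ppa_fillings n w" and eq: "?F A = ?F B"
    then have AB: "A \<in> SE_diagram n w \<rightarrow>\<^sub>E {0, 1}" "B \<in> SE_diagram n w \<rightarrow>\<^sub>E {0, 1}"
      by (auto simp: ppa_fillings_def)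
    show "A = B"
    proof (rule PiE_ext[OF AB])
      fix c assume c: "c \<in> SE_diagram n w"
      then obtain i k where ik: "c = (i, w k)" "(i, k) \<in> inversions n w"
        using col[of "fst c" "snd c"] by (metis prod.collapse)
      \<comment> \<open>Hence the arc from \<open>i\<close> to \<open>k\<close> can come only from
        the value 1 in the cell \<open>c\<close>, and the orientation determines that value.\<close>
      then have "(k, i) \<notin> inversions n w" by (auto simp: inversions_def)
      moreover have "(i, k) \<in> ?F A \<longleftrightarrow> (i, k) \<in> ?F B" using eq by simp
      ultimately have "A c = 1 \<longleftrightarrow> B c = 1" using ik by (simp add: filling_orientation_def)
      moreover have "A c \<in> {0, 1}" "B c \<in> {0, 1}"
        using PiE_mem[OF AB(1) c] PiE_mem[OF AB(2) c] by simp_all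
      ultimately show "A c = B c" by auto
    qed
  qed
  have img: "?F ` ppa_fillings n w = acyclic_orientations (inversion_graph n w)"
  proof
    show "?F ` ppa_fillings n w \<subseteq> acyclic_orientations (inversion_graph n w)"
    proof clarify
      fix A assume "A \<in> ppa_fillings n w"
      then have A: "A \<in> SE_diagram n w \<rightarrow> {0, 1}" "pseudo_percentage_avoiding n w A"
        by (auto simp: ppa_fillings_def PiE_def)
      have A0: "A (x, w y) = 0 \<longleftrightarrow> A (x, w y) \<noteq> 1" if "(x, y) \<in> inversions n w" for x y
      proof -
        have "A (x, w y) \<in> {0, 1}"
          using Pi_mem[OF A(1), of "(x, w y)"] that unfolding SE by blast
        then show ?thesis by auto
      qed
      have "is_orientation (inversion_graph n w) (?F A)"
        unfolding orient
      proof (intro conjI ballI impI)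
        show "?F A \<subseteq> {(x, y). x \<in> {1..n} \<and> y \<in> {1..n} \<and> ?E x y}"
          by (auto simp: filling_orientation_def inv_iff)
        fix x y assume "x \<in> {1..n}" "y \<in> {1..n}" "?E x y"
        then consider "(x, y) \<in> inversions n w" "(y, x) \<notin> inversions n w"
          | "(y, x) \<in> inversions n w" "(x, y) \<notin> inversions n w"
          by (auto simp: inv_iff)
        then show "(x, y) \<in> ?F A \<longleftrightarrow> (y, x) \<notin> ?F A"
          by cases (simp_all add: filling_orientation_def A0)
      qed
      then show "?F A \<in> acyclic_orientations (inversion_graph n w)"
        using acyclic_filling_orientation_iff[OF w A(1)] A(2) by (simp add: acyclic_orientations_def)
    qed
    show "acyclic_orientations (inversion_graph n w) \<subseteq> ?F ` ppa_fillings n w"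
    proof
      fix D assume "D \<in> acyclic_orientations (inversion_graph n w)"
      then have D: "is_orientation (inversion_graph n w) D" "acyclic D"
        by (auto simp: acyclic_orientations_def)
      \<comment> \<open>The inverse map: \<open>inv w j\<close> recovers the position of the entry
        in column \<open>j\<close>, and restricting to the diagram makes the filling
        extensional.\<close>
      define A where
        "A = (\<lambda>(i, j)\<in>SE_diagram n w. if (i, inv w j) \<in> D then 1 else 0 :: nat)"
      have A: "A (i, w k) = (if (i, k) \<in> D then 1 else 0)" if "(i, k) \<in> inversions n w" for i k
        using that SE permutes_inverses[OF w] by (simp add: A_def)
      have ext: "A \<in> SE_diagram n w \<rightarrow>\<^sub>E {0, 1}" by (auto simp: A_def split: if_splits)
      have "(x, y) \<in> ?F A \<longleftrightarrow> (x, y) \<in> D" for x y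
      proof -
        have "(x, y) \<in> ?F A \<longleftrightarrow> (x, y) \<in> inversions n w \<and> (x, y) \<in> D \<or>
            (y, x) \<in> inversions n w \<and> (y, x) \<notin> D"
          using A by (auto simp: filling_orientation_def split: if_splits)
        also have "\<dots> \<longleftrightarrow> (x, y) \<in> D" using D(1) unfolding orient inv_iff by blast
        finally show ?thesis .
      qed
      then have "?F A = D" by auto
      moreover have "A \<in> SE_diagram n w \<rightarrow> {0, 1}" using ext by (simp add: PiE_def)
      then have "pseudo_percentage_avoiding n w A"
        using acyclic_filling_orientation_iff[OF w, of A] \<open>?F A = D\<close> D(2) by blast
      then have "A \<in> ppa_fillings n w" using ext by (simp add: ppa_fillings_def)
      ultimately show "D \<in> ?F ` ppa_fillings n w" by blast
    qed
  qed
  show ?thesis unfolding img[symmetric] by (rule card_image[OF inj, symmetric])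
qed

theorem theorem2p1:
  fixes n :: nat and w :: "nat \<Rightarrow> nat"
  assumes "n \<ge> 1" and "w permutes {1..n}"
  shows "card (acyclic_orientations (inversion_graph n w)) =
           card (rook_placements n (({1..n} \<times> {1..n}) - SW_diagram n w))
       \<and> card (rook_placements n (({1..n} \<times> {1..n}) - SW_diagram n w)) =
           card (ppa_fillings n w)"
proof -
  have w_eq: "w x = w y \<longleftrightarrow> x = y" for x y
    using permutes_inj[OF assms(2)] by (auto dest: injD)
  \<comment> \<open>By injectivity of \<open>w\<close>, two distinct positions incomparable under
    \<open>P\<close> form an inversion in one of the two orders.\<close>
  have "card (acyclic_orientations (inversion_graph n w)) =
      card {xs. distinct xs \<and> set xs = {1..n} \<and> successively (\<lambda>x y. \<not> (y < x \<and> w y < w x)) xs}"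
    unfolding inversion_graph_eq
    by (rule card_acyclic_orientations_incomparability)
      (auto simp: not_less le_less w_eq intro: transpI irreflpI)
  also have "\<dots> = card {xs \<in> {xs. distinct xs \<and> set xs = {1..n}}.
      \<forall>(y, x)\<in>desc_pairs xs. \<not> w y < w x}"
    using successively_iff_desc_pairs[of "\<lambda>y x. w y < w x"] by (simp add: conj_assoc)
  \<comment> \<open>The condition depends only on the set of pairs, so it is an admissible
    \<open>Q\<close> for the equidistribution.\<close>
  also have "\<dots> = card {p \<in> {p. p permutes {1..n}}. \<forall>(i, j)\<in>exc_pairs p. \<not> w i < w j}"
    by (rule card_desc_pairs_eq_exc_pairs)
  also have "\<dots> = card (rook_placements n ({1..n} \<times> {1..n} - SW_diagram n w))"
    using card_rook_placements[OF assms(2)] by simp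
  finally show ?thesis using card_ppa_fillings[OF assms(2)] by simp
qed

end
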